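(* Let $G$ and $H$ be finitely generated nilpotent groups, $M$ a finitely generated conically pre-ordered commutative monoid, and $\alpha:G\to H$ an isomorphism. If $\phi$ is a finite, inertia-free, faithful $(M,G)$-filter, then $\alpha$ is a lift of the induced $M$-graded Lie ring isomorphism $\hat\alpha:L(\phi)\to L(\phi^\alpha)$.
   Context: A conically pre-ordered monoid is a commutative monoid $M$ (written additively) with a pre-order $\preceq$ such that $s\preceq t$, $s'\preceq t'$ imply $s+s'\preceq t+t'$, and with minimal element $0$ (that is, $0\preceq s$ for all $s$, and $s\preceq 0$ only if $s=0$). An $(M,G)$-filter is a function $\phi$ from $M$ to the set of normal subgroups of $G$, $s\mapsto\phi_s$, with $\langle \phi_s: s\neq 0\rangle=G$, $\bigcap_{s\in M}\phi_s=1$, and for all $s,t\in M$: $[\phi_s,\phi_t]\le\phi_{s+t}$, and $s\preceq t\Rightarrow \phi_s\ge\phi_t$. It is finite if $\operatorname{im}(\phi)$ is a finite set. Here $\partial\phi_s=\langle\phi_{s+t}: t\ne 0\rangle$ and $L(\phi)=\bigoplus_{s\ne0}L_s(\phi)$, $L_s(\phi)=\phi_s/\partial\phi_s$, is the $M$-graded Lie ring with bracket $[x\partial\phi_s,y\partial\phi_t]=[x,y]\partial\phi_{s+t}$. Inertia-free: let $\mathfrak B_0=\{\langle1\rangle\}$, $\mathfrak B_{i+1}=\{\phi_s : \exists B\subseteq\mathfrak B_i,\ \partial\phi_s=\langle B\rangle\}$, $\mathfrak B=\bigcup_{i\ge0}\mathfrak B_i$; $\phi$ is inertia-free if $\mathfrak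 B=\operatorname{im}(\phi)$. Faithful: $\operatorname{Lat}(\phi)$ is the closure of $\operatorname{im}(\phi)$ under intersections and products of subgroups. $\phi$ is faithful if there is $\mathcal X\subseteq G$ such that (i) $\langle K\cap\mathcal X\rangle=K$ for all $K\in\operatorname{Lat}(\phi)$; (ii) $K\mapsto K\cap\mathcal X$ is a lattice embedding of $\operatorname{Lat}(\phi)$ into the lattice of subsets of $\mathcal X$ (with $\cap,\cup$); (iii) for each $x\in\mathcal X$ there is a unique $s\in M$ with $x\in\phi_s\setminus\partial\phi_s$. Induced maps: for an isomorphism $\alpha:G\to H$, $\phi^\alpha$ is the $(M,H)$-filter $(\phi^\alpha)_s=(\phi_s)^\alpha$, and $\hat\alpha:L(\phi)\to L(\phi^\alpha)$ is the $M$-graded Lie isomorphism given on $L_s(\phi)$ by $\partial\phi_s x\mapsto \partial(\phi^\alpha)_s\,x^\alpha$. Lifts: let $\phi$ be an $(M,G)$-filter, $\theta$ an $(M,H)$-filter, $\beta:L(\phi)\to L(\theta)$ an $M$-graded isomorphism, and $\mathcal I_\phi=\{s\in M: \partial\phi_s\ne\phi_s\text{ or }\phi_s=1\}$. For each $s$ choose transversals (set-theoretic sections) $\tau_s:\phi_s/\partial\phi_s\to\phi_s$ and $\sigma_s:\theta_s/\partial\theta_s\to\theta_s$, and let $\mathcal X_s$ be the image under $\tau_s$ of a generating set of $L_s(\phi)$. The corresponding partial lift of $\beta$ is the function $\bigsqcup_{s\in\mathcal I_\phi}\mathcal X_s\to H$ sending $x\in\mathcal X_s$ to $(\partial\phi_s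 x)^{\beta\sigma_s}$. A homomorphism $G\to H$ is a lift of $\beta$ if, for some such choices, it is induced by the partial lift, i.e. $\bigcup_{s\in\mathcal I_\phi}\mathcal X_s$ generates $G$ and the homomorphism agrees with the partial lift on every $\mathcal X_s$. *)

theory Defs
  imports "HOL-Algebra.Algebra"
begin

section \<open>Finitely generated and nilpotent groups\<close>

definition finitely_generated_group :: "('a, 'b) monoid_scheme \<Rightarrow> bool" where
  "finitely_generated_group G \<longleftrightarrow>
     group G \<and> (\<exists>S. finite S \<and> S \<subseteq> carrier G \<and> generate G S = carrier G)"

definition commutator :: "('a, 'b) monoid_scheme \<Rightarrow> 'a \<Rightarrow> 'a \<Rightarrow> 'a" where
  "commutator G x y = inv\<^bsub>G\<^esub> x \<otimes>\<^bsub>G\<^esub> inv\<^bsub>G\<^esub> y \<otimes>\<^bsub>G\<^esub> x \<otimes>\<^bsub>G\<^esub> y"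

definition commutator_subgroup :: "('a, 'b) monoid_scheme \<Rightarrow> 'a set \<Rightarrow> 'a set \<Rightarrow> 'a set" where
  "commutator_subgroup G A B = generate G {commutator G x y | x y. x \<in> A \<and> y \<in> B}"

primrec lower_central_series :: "('a, 'b) monoid_scheme \<Rightarrow> nat \<Rightarrow> 'a set" where
  "lower_central_series G 0 = carrier G"
| "lower_central_series G (Suc n) = commutator_subgroup G (lower_central_series G n) (carrier G)"

definition nilpotent_group :: "('a, 'b) monoid_scheme \<Rightarrow> bool" where
  "nilpotent_group G \<longleftrightarrow> group G \<and> (\<exists>n. lower_central_series G n = {\<one>\<^bsub>G\<^esub>})"


section \<open>Conically pre-ordered monoids\<close>

text \<open>The monoid is a type of class \<^class>\<open>comm_monoid_add\<close>; the pre-order is an explicit relation,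
  since it need not be antisymmetric.\<close>

definition conically_preordered :: "('m::comm_monoid_add \<Rightarrow> 'm \<Rightarrow> bool) \<Rightarrow> bool" where
  "conically_preordered pre \<longleftrightarrow>
     reflp pre \<and> transp pre \<and>
     (\<forall>s t s' t'. pre s t \<longrightarrow> pre s' t' \<longrightarrow> pre (s + s') (t + t')) \<and>
     (\<forall>s. pre 0 s) \<and> (\<forall>s. pre s 0 \<longrightarrow> s = 0)"

definition finitely_generated_monoid :: "'m::comm_monoid_add itself \<Rightarrow> bool" where
  "finitely_generated_monoid _ \<longleftrightarrow>
     (\<exists>S::'m set. finite S \<and> (\<lambda>T. 0 \<in> T \<and> (\<forall>x\<in>T. \<forall>y\<in>T. x + y \<in> T)) hull S = UNIV)"


section \<open>Filters\<close>

definition mg_filter ::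
  "('m::comm_monoid_add \<Rightarrow> 'm \<Rightarrow> bool) \<Rightarrow> ('a, 'b) monoid_scheme \<Rightarrow> ('m \<Rightarrow> 'a set) \<Rightarrow> bool" where
  "mg_filter pre G \<phi> \<longleftrightarrow>
     (\<forall>s. \<phi> s \<lhd> G) \<and>
     generate G (\<Union>s\<in>{s. s \<noteq> 0}. \<phi> s) = carrier G \<and>
     (\<Inter>s. \<phi> s) = {\<one>\<^bsub>G\<^esub>} \<and>
     (\<forall>s t. commutator_subgroup G (\<phi> s) (\<phi> t) \<subseteq> \<phi> (s + t)) \<and>
     (\<forall>s t. pre s t \<longrightarrow> \<phi> t \<subseteq> \<phi> s)"

definition finite_filter :: "('m \<Rightarrow> 'a set) \<Rightarrow> bool" where
  "finite_filter \<phi> \<longleftrightarrow> finite (range \<phi>)"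

definition boundary ::
  "('a, 'b) monoid_scheme \<Rightarrow> ('m::comm_monoid_add \<Rightarrow> 'a set) \<Rightarrow> 'm \<Rightarrow> 'a set" where
  "boundary G \<phi> s = generate G (\<Union>t\<in>{t. t \<noteq> 0}. \<phi> (s + t))"

primrec inertia_free_level ::
  "('a, 'b) monoid_scheme \<Rightarrow> ('m::comm_monoid_add \<Rightarrow> 'a set) \<Rightarrow> nat \<Rightarrow> 'a set set" where
  "inertia_free_level G \<phi> 0 = {{\<one>\<^bsub>G\<^esub>}}"
| "inertia_free_level G \<phi> (Suc i) =
     {\<phi> s | s. \<exists>B \<subseteq> inertia_free_level G \<phi> i. boundary G \<phi> s = generate G (\<Union>B)}"

definition inertia_free ::
  "('a, 'b) monoid_scheme \<Rightarrow> ('m::comm_monoid_add \<Rightarrow> 'a set) \<Rightarrow> bool" where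
  "inertia_free G \<phi> \<longleftrightarrow> (\<Union>i. inertia_free_level G \<phi> i) = range \<phi>"

inductive_set filter_lattice :: "('a, 'b) monoid_scheme \<Rightarrow> ('m \<Rightarrow> 'a set) \<Rightarrow> 'a set set"
  for G (structure) and \<phi> where
  base: "\<phi> s \<in> filter_lattice G \<phi>"
| inter: "K \<in> filter_lattice G \<phi> \<Longrightarrow> L \<in> filter_lattice G \<phi> \<Longrightarrow> K \<inter> L \<in> filter_lattice G \<phi>"
| product: "K \<in> filter_lattice G \<phi> \<Longrightarrow> L \<in> filter_lattice G \<phi> \<Longrightarrow> K <#> L \<in> filter_lattice G \<phi>"

definition faithful_filter ::
  "('a, 'b) monoid_scheme \<Rightarrow> ('m::comm_monoid_add \<Rightarrow> 'a set) \<Rightarrow> bool" where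
  "faithful_filter G \<phi> \<longleftrightarrow>
     (\<exists>S \<subseteq> carrier G.
        (\<forall>K \<in> filter_lattice G \<phi>. generate G (K \<inter> S) = K) \<and>
        inj_on (\<lambda>K. K \<inter> S) (filter_lattice G \<phi>) \<and>
        (\<forall>K \<in> filter_lattice G \<phi>. \<forall>L \<in> filter_lattice G \<phi>.
           (K \<inter> L) \<inter> S = (K \<inter> S) \<inter> (L \<inter> S) \<and>
           (K <#>\<^bsub>G\<^esub> L) \<inter> S = (K \<inter> S) \<union> (L \<inter> S)) \<and>
        (\<forall>x \<in> S. \<exists>!s. x \<in> \<phi> s - boundary G \<phi> s))"


section \<open>The graded Lie ring of a filter\<close>

text \<open>The additive group of a Lie ring is written multiplicatively, as a \<^type>\<open>monoid\<close> record.\<close>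

record 'a lie_ring = "'a monoid" +
  lie :: "'a \<Rightarrow> 'a \<Rightarrow> 'a"

definition filter_quotient ::
  "('a, 'b) monoid_scheme \<Rightarrow> ('m::comm_monoid_add \<Rightarrow> 'a set) \<Rightarrow> 'm \<Rightarrow> 'a set monoid" where
  "filter_quotient G \<phi> s = (G\<lparr>carrier := \<phi> s\<rparr>) Mod boundary G \<phi> s"

text \<open>The bracket of a coset in degree \<open>s\<close> with a coset in degree \<open>t\<close>. The image below is a
  singleton when \<open>\<phi>\<close> is a filter and \<open>s\<close>, \<open>t\<close> are nonzero.\<close>

definition homogeneous_lie ::
  "('a, 'b) monoid_scheme \<Rightarrow> ('m::comm_monoid_add \<Rightarrow> 'a set) \<Rightarrow> 'm \<Rightarrow> 'm \<Rightarrow> 'a set \<Rightarrow> 'a set \<Rightarrow> 'a set"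
  where
  "homogeneous_lie G \<phi> s t C D =
     the_elem ((\<lambda>(x, y). boundary G \<phi> (s + t) #>\<^bsub>G\<^esub> commutator G x y) ` (C \<times> D))"

text \<open>The bracket is extended biadditively to the direct sum, so its component in degree \<open>u\<close> is the
  sum of the brackets of components in nonzero degrees \<open>s\<close>, \<open>t\<close> with \<open>s + t = u\<close>; it suffices to
  sum over the (finite) supports.\<close>

definition filter_lie_ring ::
  "('a, 'b) monoid_scheme \<Rightarrow> ('m::comm_monoid_add \<Rightarrow> 'a set) \<Rightarrow> ('m \<Rightarrow> 'a set) lie_ring" where
  "filter_lie_ring G \<phi> =
     (let S = sum_group {s. s \<noteq> 0} (filter_quotient G \<phi>) in
      \<lparr>carrier = carrier S, monoid.mult = monoid.mult S, one = one S,
       lie = (\<lambda>f g. \<lambda>u\<in>{u. u \<noteq> 0}.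
         finprod (filter_quotient G \<phi> u)
           (\<lambda>(s, t). homogeneous_lie G \<phi> s t (f s) (g t))
           {(s, t). s \<noteq> 0 \<and> t \<noteq> 0 \<and> s + t = u \<and>
              f s \<noteq> \<one>\<^bsub>filter_quotient G \<phi> s\<^esub> \<and> g t \<noteq> \<one>\<^bsub>filter_quotient G \<phi> t\<^esub>})\<rparr>)"

definition in_degree ::
  "('a, 'b) monoid_scheme \<Rightarrow> ('m::comm_monoid_add \<Rightarrow> 'a set) \<Rightarrow> 'm \<Rightarrow> 'a set \<Rightarrow> ('m \<Rightarrow> 'a set)" where
  "in_degree G \<phi> s C = (\<lambda>t\<in>{t. t \<noteq> 0}. if t = s then C else \<one>\<^bsub>filter_quotient G \<phi> t\<^esub>)"

definition homogeneous_component ::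
  "('a, 'b) monoid_scheme \<Rightarrow> ('m::comm_monoid_add \<Rightarrow> 'a set) \<Rightarrow> 'm \<Rightarrow> ('m \<Rightarrow> 'a set) set" where
  "homogeneous_component G \<phi> s = in_degree G \<phi> s ` carrier (filter_quotient G \<phi> s)"

definition graded_lie_iso ::
  "('a, 'b) monoid_scheme \<Rightarrow> ('m::comm_monoid_add \<Rightarrow> 'a set) \<Rightarrow>
   ('c, 'd) monoid_scheme \<Rightarrow> ('m \<Rightarrow> 'c set) \<Rightarrow> (('m \<Rightarrow> 'a set) \<Rightarrow> ('m \<Rightarrow> 'c set)) \<Rightarrow> bool" where
  "graded_lie_iso G \<phi> H \<theta> \<beta> \<longleftrightarrow>
     \<beta> \<in> iso (filter_lie_ring G \<phi>) (filter_lie_ring H \<theta>) \<and>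
     (\<forall>f \<in> carrier (filter_lie_ring G \<phi>). \<forall>g \<in> carrier (filter_lie_ring G \<phi>).
        \<beta> (lie (filter_lie_ring G \<phi>) f g) = lie (filter_lie_ring H \<theta>) (\<beta> f) (\<beta> g)) \<and>
     (\<forall>s. s \<noteq> 0 \<longrightarrow> \<beta> ` homogeneous_component G \<phi> s = homogeneous_component H \<theta> s)"


section \<open>Induced maps\<close>

definition induced_filter :: "('a \<Rightarrow> 'c) \<Rightarrow> ('m \<Rightarrow> 'a set) \<Rightarrow> 'm \<Rightarrow> 'c set" where
  "induced_filter \<alpha> \<phi> s = \<alpha> ` \<phi> s"

text \<open>On degree \<open>s\<close>, the coset of \<open>x\<close> modulo \<open>boundary G \<phi> s\<close> goes to the coset of \<open>\<alpha> x\<close> modulo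
  \<open>boundary H (induced_filter \<alpha> \<phi>) s\<close>.\<close>

definition induced_lie_map ::
  "('m::comm_monoid_add \<Rightarrow> 'a set) \<Rightarrow> ('c, 'd) monoid_scheme \<Rightarrow>
   ('a \<Rightarrow> 'c) \<Rightarrow> ('m \<Rightarrow> 'a set) \<Rightarrow> ('m \<Rightarrow> 'c set)" where
  "induced_lie_map \<phi> H \<alpha> f =
     (\<lambda>s\<in>{s. s \<noteq> 0}. the_elem ((\<lambda>x. boundary H (induced_filter \<alpha> \<phi>) s #>\<^bsub>H\<^esub> \<alpha> x) ` f s))"


section \<open>Lifts\<close>

definition lift_indices ::
  "('a, 'b) monoid_scheme \<Rightarrow> ('m::comm_monoid_add \<Rightarrow> 'a set) \<Rightarrow> 'm set" where
  "lift_indices G \<phi> = {s. boundary G \<phi> s \<noteq> \<phi> s \<or> \<phi> s = {\<one>\<^bsub>G\<^esub>}}"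

definition transversal ::
  "('a, 'b) monoid_scheme \<Rightarrow> ('m::comm_monoid_add \<Rightarrow> 'a set) \<Rightarrow> 'm \<Rightarrow> ('a set \<Rightarrow> 'a) \<Rightarrow> bool" where
  "transversal G \<phi> s \<tau> \<longleftrightarrow> (\<forall>C \<in> carrier (filter_quotient G \<phi> s). \<tau> C \<in> C)"

text \<open>The restriction of a graded map to degree \<open>s\<close>. Degree \<open>0\<close> is not a summand of the Lie ring;
  for filters \<open>\<phi> 0 = boundary G \<phi> 0 = carrier G\<close>, so the quotient in degree \<open>0\<close> is trivial
  and the map in that degree is the only possible one. (Degree \<open>0\<close> belongs to
  \<open>lift_indices G \<phi>\<close> exactly when the group is trivial.)\<close>

definition graded_part ::
  "('a, 'b) monoid_scheme \<Rightarrow> ('m::comm_monoid_add \<Rightarrow> 'a set) \<Rightarrow>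
   ('c, 'd) monoid_scheme \<Rightarrow> ('m \<Rightarrow> 'c set) \<Rightarrow> (('m \<Rightarrow> 'a set) \<Rightarrow> ('m \<Rightarrow> 'c set)) \<Rightarrow>
   'm \<Rightarrow> 'a set \<Rightarrow> 'c set" where
  "graded_part G \<phi> H \<theta> \<beta> s C =
     (if s = 0 then \<one>\<^bsub>filter_quotient H \<theta> 0\<^esub> else \<beta> (in_degree G \<phi> s C) s)"

definition partial_lift ::
  "('a, 'b) monoid_scheme \<Rightarrow> ('m::comm_monoid_add \<Rightarrow> 'a set) \<Rightarrow>
   ('c, 'd) monoid_scheme \<Rightarrow> ('m \<Rightarrow> 'c set) \<Rightarrow> (('m \<Rightarrow> 'a set) \<Rightarrow> ('m \<Rightarrow> 'c set)) \<Rightarrow>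
   ('m \<Rightarrow> 'c set \<Rightarrow> 'c) \<Rightarrow> 'm \<Rightarrow> 'a \<Rightarrow> 'c" where
  "partial_lift G \<phi> H \<theta> \<beta> \<sigma> s x =
     \<sigma> s (graded_part G \<phi> H \<theta> \<beta> s (boundary G \<phi> s #>\<^bsub>G\<^esub> x))"

text \<open>Here \<open>Y s\<close> is the chosen generating set of the quotient in degree \<open>s\<close> and \<open>\<tau> s ` Y s\<close> is the
  set of representatives on which the partial lift is defined. The partial lift has the disjoint
  union of these sets as its domain, so it depends on \<open>s\<close> as well as on the representative.\<close>

definition lift_of ::
  "('m::comm_monoid_add \<Rightarrow> 'm \<Rightarrow> bool) \<Rightarrow>
   ('a, 'b) monoid_scheme \<Rightarrow> ('m \<Rightarrow> 'a set) \<Rightarrow>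
   ('c, 'd) monoid_scheme \<Rightarrow> ('m \<Rightarrow> 'c set) \<Rightarrow>
   (('m \<Rightarrow> 'a set) \<Rightarrow> ('m \<Rightarrow> 'c set)) \<Rightarrow> ('a \<Rightarrow> 'c) \<Rightarrow> bool" where
  "lift_of pre G \<phi> H \<theta> \<beta> h \<longleftrightarrow>
     mg_filter pre G \<phi> \<and> mg_filter pre H \<theta> \<and> graded_lie_iso G \<phi> H \<theta> \<beta> \<and> h \<in> hom G H \<and>
     (\<exists>\<tau> \<sigma> Y.
        (\<forall>s. transversal G \<phi> s (\<tau> s)) \<and>
        (\<forall>s. transversal H \<theta> s (\<sigma> s)) \<and>
        (\<forall>s. Y s \<subseteq> carrier (filter_quotient G \<phi> s) \<and>
             generate (filter_quotient G \<phi> s) (Y s) = carrier (filter_quotient G \<phi> s)) \<and>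
        generate G (\<Union>s\<in>lift_indices G \<phi>. \<tau> s ` Y s) = carrier G \<and>
        (\<forall>s\<in>lift_indices G \<phi>. \<forall>x\<in>\<tau> s ` Y s. h x = partial_lift G \<phi> H \<theta> \<beta> \<sigma> s x))"

end

theory Submission
  imports Defs
begin

text \<open>
  The lift is built from full transversals: the generating set of the factor
  \<open>\<phi>\<^sub>s / \<partial>\<phi>\<^sub>s\<close> is the whole factor, \<open>\<tau>\<^sub>s\<close> is an arbitrary choice of representatives, and
  the section on the other side is the transported one, \<open>\<sigma>\<^sub>s (\<alpha> ` C) = \<alpha> (\<tau>\<^sub>s C)\<close>. A
  representative \<open>x = \<tau>\<^sub>s C\<close> is then sent by the partial lift to \<open>\<sigma>\<^sub>s (\<alpha> ` C) = \<alpha> x\<close>, so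
  \<open>\<alpha>\<close> agrees with the partial lift wherever the latter is defined.

  What has content is that the representatives in the degrees of \<open>lift_indices\<close> generate
  the group (\<open>representatives_generate\<close>), and this is what inertia-freeness provides. Let
  \<open>K\<close> be the subgroup they generate. As soon as \<open>K\<close> contains \<open>\<partial>\<phi>\<^sub>s\<close> it contains
  \<open>\<phi>\<^sub>s\<close>: either the two subgroups coincide, or \<open>s\<close> is a lift index and
  \<open>\<phi>\<^sub>s\<close> is the product of \<open>\<partial>\<phi>\<^sub>s\<close> and the transversal. The levels of the inertia-free
  filtration start at the trivial group and obtain each new \<open>\<phi>\<^sub>s\<close> from a boundary generated by
  earlier terms, so \<open>K\<close> contains every term by induction on the level, in particular
  \<open>\<phi>\<^sub>0\<close>, which is the whole group.

  The rest is transport of structure. On a coset \<open>C\<close> of \<open>\<partial>\<phi>\<^sub>s\<close> the induced map is the image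
  \<open>\<alpha> ` C\<close> (\<open>the_elem_image_coset\<close>), which identifies the factors of \<open>\<phi>\<close> with those of the
  induced filter. For the bracket to be transported, its defining expression in terms of
  representatives must not depend on their choice (\<open>homogeneous_lie_coset\<close>); this rests on
  \<open>[\<partial>\<phi>\<^sub>s, \<phi>\<^sub>t] \<le> \<partial>\<phi>\<^sub>s\<^sub>+\<^sub>t\<close>.
\<close>

section \<open>Commutators\<close>

context group
begin

lemma commutator_eq_inv_mult:
  assumes "x \<in> carrier G" "y \<in> carrier G"
  shows "commutator G x y = inv (y \<otimes> x) \<otimes> (x \<otimes> y)"
  using assms by (simp add: commutator_def inv_mult_group m_assoc)

lemma commutator_closed [simp]:
  assumes "x \<in> carrier G" "y \<in> carrier G"
  shows "commutator G x y \<in> carrier G"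
  using assms by (simp add: commutator_def)

lemma commutator_eq_one_iff:
  assumes "x \<in> carrier G" "y \<in> carrier G"
  shows "commutator G x y = \<one> \<longleftrightarrow> x \<otimes> y = y \<otimes> x"
  using assms by (metis commutator_eq_inv_mult inv_equality inv_inv inv_closed m_closed l_inv)

text \<open>Passing to a quotient turns the factors \<open>a\<close> and \<open>b\<close>, by which two representatives of a
  coset differ, into elements that commute as required here; the commutator then does not see
  them.\<close>

lemma commutator_mult_commuting:
  assumes "a \<in> carrier G" "b \<in> carrier G" "x \<in> carrier G" "y \<in> carrier G"
    and "a \<otimes> b = b \<otimes> a" "a \<otimes> y = y \<otimes> a" "b \<otimes> x = x \<otimes> b"
  shows "commutator G (a \<otimes> x) (b \<otimes> y) = commutator G x y"
proof -
  have "(a \<otimes> x) \<otimes> (b \<otimes> y) = (a \<otimes> b) \<otimes> (x \<otimes> y)"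
    using assms by (metis m_assoc m_closed)
  moreover have "(b \<otimes> y) \<otimes> (a \<otimes> x) = (a \<otimes> b) \<otimes> (y \<otimes> x)"
    using assms by (metis m_assoc m_closed)
  moreover have "inv (c \<otimes> v) \<otimes> (c \<otimes> u) = inv v \<otimes> u"
    if "c \<in> carrier G" "u \<in> carrier G" "v \<in> carrier G" for c u v
  proof -
    have "inv c \<otimes> (c \<otimes> u) = u"
      using that by (simp flip: m_assoc)
    then show ?thesis
      using that by (simp add: inv_mult_group m_assoc)
  qed
  ultimately show ?thesis
    using assms by (simp add: commutator_eq_inv_mult)
qed

lemma commuting_elements_subgroup:
  assumes "Y \<subseteq> carrier G"
  shows "subgroup {a \<in> carrier G. \<forall>y\<in>Y. a \<otimes> y = y \<otimes> a} G"
proof (rule subgroupI)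
  fix a assume a: "a \<in> {a \<in> carrier G. \<forall>y\<in>Y. a \<otimes> y = y \<otimes> a}"
  have "inv a \<otimes> y = y \<otimes> inv a" if "y \<in> Y" for y
  proof -
    have "y \<in> carrier G" "a \<in> carrier G" "a \<otimes> y = y \<otimes> a"
      using that a assms by auto
    then show ?thesis
      by (metis inv_solve_left inv_solve_right inv_closed m_assoc m_closed)
  qed
  with a show "inv a \<in> {a \<in> carrier G. \<forall>y\<in>Y. a \<otimes> y = y \<otimes> a}" by simp
next
  fix a b assume "a \<in> {a \<in> carrier G. \<forall>y\<in>Y. a \<otimes> y = y \<otimes> a}"
    "b \<in> {a \<in> carrier G. \<forall>y\<in>Y. a \<otimes> y = y \<otimes> a}"
  then show "a \<otimes> b \<in> {a \<in> carrier G. \<forall>y\<in>Y. a \<otimes> y = y \<otimes> a}"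
    using assms by (auto simp: subset_iff) (metis m_assoc)
qed (use assms in \<open>auto intro!: exI[of _ \<one>]\<close>)

end

lemma (in group_hom) hom_commutator:
  assumes "x \<in> carrier G" "y \<in> carrier G"
  shows "h (commutator G x y) = commutator H (h x) (h y)"
  using assms by (simp add: commutator_def)

lemma (in group_hom) subgroup_preimage:
  assumes "subgroup K H"
  shows "subgroup {x \<in> carrier G. h x \<in> K} G"
proof (rule G.subgroupI)
  have "\<one> \<in> {x \<in> carrier G. h x \<in> K}"
    using subgroup.one_closed[OF assms] by simp
  then show "{x \<in> carrier G. h x \<in> K} \<noteq> {}" by blast
qed (use assms in \<open>auto simp: subgroup.m_closed subgroup.m_inv_closed\<close>)

lemma (in group_hom) image_r_coset:
  assumes "K \<subseteq> carrier G" "x \<in> carrier G"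
  shows "h ` (K #>\<^bsub>G\<^esub> x) = h ` K #>\<^bsub>H\<^esub> h x"
  using assms by (auto simp: r_coset_def subset_iff image_iff)

lemma (in group_hom) image_set_mult:
  assumes "K \<subseteq> carrier G" "L \<subseteq> carrier G"
  shows "h ` (K <#>\<^bsub>G\<^esub> L) = h ` K <#>\<^bsub>H\<^esub> h ` L"
  using assms by (force simp: set_mult_def subset_iff image_iff)

lemma (in group_hom) image_commutator_subgroup:
  assumes "K \<subseteq> carrier G" "L \<subseteq> carrier G"
  shows "commutator_subgroup H (h ` K) (h ` L) = h ` commutator_subgroup G K L"
proof -
  have "{commutator H x y | x y. x \<in> h ` K \<and> y \<in> h ` L}
      = h ` {commutator G x y | x y. x \<in> K \<and> y \<in> L}"
    using assms by (fastforce simp: hom_commutator subset_iff image_iff)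
  moreover have "{commutator G x y | x y. x \<in> K \<and> y \<in> L} \<subseteq> carrier G"
    using assms by (auto simp: subset_iff)
  ultimately show ?thesis
    by (simp add: commutator_subgroup_def generate_img)
qed

text \<open>An infinite index set is harmless, since both products are then the unit.\<close>

lemma hom_finprod_comm_group:
  assumes "comm_group A" "comm_group B" "h \<in> hom A B" "f \<in> I \<rightarrow> carrier A"
  shows "h (finprod A f I) = finprod B (\<lambda>i. h (f i)) I"
proof -
  interpret A: comm_group A by fact
  interpret B: comm_group B by fact
  interpret group_hom A B h
    using assms by unfold_locales
  show ?thesis
    using assms(4) by (induct I rule: infinite_finite_induct) (auto simp: Pi_def)
qed

text \<open>The commutator of two cosets is the coset of the commutator, and it is trivial exactly when
  the cosets commute.\<close>

lemma (in group) cosets_commute_if_commutator_mem: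
  assumes "x \<in> carrier G" "y \<in> carrier G" "N \<lhd> G" "commutator G x y \<in> N"
  shows "(N #> x) \<otimes>\<^bsub>G Mod N\<^esub> (N #> y) = (N #> y) \<otimes>\<^bsub>G Mod N\<^esub> (N #> x)"
proof -
  interpret N: normal N G by fact
  interpret Q: group "G Mod N" by (rule N.factorgroup_is_group)
  interpret p: group_hom G "G Mod N" "\<lambda>x. N #> x"
    by unfold_locales (rule N.r_coset_hom_Mod)
  have "commutator (G Mod N) (N #> x) (N #> y) = N #> commutator G x y"
    using assms by (simp only: p.hom_commutator)
  also have "\<dots> = \<one>\<^bsub>G Mod N\<^esub>"
    using assms coset_join2[OF _ N.subgroup_axioms] by simp
  finally show ?thesis
    using assms Q.commutator_eq_one_iff p.hom_closed by blast
qed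

section \<open>Filters and their factors\<close>

text \<open>Compatibility of the pre-order with addition turns \<open>0 \<preceq> t\<close> into \<open>s \<preceq> s + t\<close>;
  this is why each boundary lies in its term.\<close>

locale conic_filter = group G for G :: "('a, 'b) monoid_scheme" (structure) +
  fixes pre :: "'m::comm_monoid_add \<Rightarrow> 'm \<Rightarrow> bool" and \<phi> :: "'m \<Rightarrow> 'a set"
  assumes conic: "conically_preordered pre"
    and filter: "mg_filter pre G \<phi>"
begin

lemma normal_term: "\<phi> s \<lhd> G"
  using filter by (simp add: mg_filter_def)

lemma subgroup_term: "subgroup (\<phi> s) G"
  by (rule normal_imp_subgroup[OF normal_term])

lemma term_subset: "\<phi> s \<subseteq> carrier G"
  by (rule subgroup.subset[OF subgroup_term])

lemma term_add_subset: "\<phi> (s + t) \<subseteq> \<phi> s"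
proof -
  have "pre s s" "pre 0 t"
    using conic by (auto simp: conically_preordered_def reflp_def)
  moreover have "\<forall>s t s' t'. pre s t \<longrightarrow> pre s' t' \<longrightarrow> pre (s + s') (t + t')"
    using conic by (simp add: conically_preordered_def)
  ultimately have "pre (s + 0) (s + t)"
    by blast
  then show ?thesis
    using filter by (simp add: mg_filter_def)
qed

lemma commutator_mem:
  assumes "x \<in> \<phi> s" "y \<in> \<phi> t"
  shows "commutator G x y \<in> \<phi> (s + t)"
proof -
  have "commutator G x y \<in> commutator_subgroup G (\<phi> s) (\<phi> t)"
    unfolding commutator_subgroup_def using assms by (blast intro: generate.incl)
  moreover have "commutator_subgroup G (\<phi> s) (\<phi> t) \<subseteq> \<phi> (s + t)"
    using filter by (simp add: mg_filter_def)
  ultimately show ?thesis by blast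
qed

lemma term_subset_boundary:
  assumes "t \<noteq> 0"
  shows "\<phi> (s + t) \<subseteq> boundary G \<phi> s"
  unfolding boundary_def using assms by (blast intro: generate.incl)

lemma boundary_least:
  assumes "subgroup K G" "\<And>t. t \<noteq> 0 \<Longrightarrow> \<phi> (s + t) \<subseteq> K"
  shows "boundary G \<phi> s \<subseteq> K"
  unfolding boundary_def using assms by (intro generate_subgroup_incl) auto

lemma normal_boundary: "boundary G \<phi> s \<lhd> G"
  unfolding boundary_def
  using term_subset normal.inv_op_closed2[OF normal_term]
  by (intro normal_generateI) auto

lemma boundary_subset_term: "boundary G \<phi> s \<subseteq> \<phi> s"
  by (intro boundary_least subgroup_term term_add_subset)

lemma boundary_subset: "boundary G \<phi> s \<subseteq> carrier G"
  using boundary_subset_term term_subset by blast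

lemma subgroup_boundary: "subgroup (boundary G \<phi> s) G"
  by (rule normal_imp_subgroup[OF normal_boundary])

lemma term_zero: "\<phi> 0 = carrier G"
proof
  have "generate G (\<Union>s\<in>{s. s \<noteq> 0}. \<phi> s) \<subseteq> \<phi> 0"
    using term_add_subset[of 0] subgroup_term by (intro generate_subgroup_incl) auto
  then show "carrier G \<subseteq> \<phi> 0"
    using filter by (simp add: mg_filter_def)
qed (rule term_subset)

lemma boundary_zero: "boundary G \<phi> 0 = carrier G"
  using filter by (simp add: boundary_def mg_filter_def)

lemma carrier_filter_quotient:
  "carrier (filter_quotient G \<phi> s) = (\<lambda>x. boundary G \<phi> s #> x) ` \<phi> s"
  by (simp add: filter_quotient_def carrier_FactGroup r_coset_def)

lemma one_filter_quotient: "\<one>\<^bsub>filter_quotient G \<phi> s\<^esub> = boundary G \<phi> s"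
  by (simp add: filter_quotient_def)

text \<open>The terms of nonzero degree generate the whole group, and they all lie in
  \<open>\<phi> 0\<close> and in \<open>boundary G \<phi> 0\<close>; the factor in degree \<open>0\<close> is therefore trivial.\<close>

lemma filter_quotient_zero:
  assumes "C \<in> carrier (filter_quotient G \<phi> 0)"
  shows "C = \<one>\<^bsub>filter_quotient G \<phi> 0\<^esub>"
proof -
  have "boundary G \<phi> 0 #> x = boundary G \<phi> 0" if "x \<in> carrier G" for x
    using that by (intro coset_join2 subgroup_boundary) (simp_all add: boundary_zero)
  then show ?thesis
    using assms by (auto simp: carrier_filter_quotient term_zero one_filter_quotient)
qed

lemma mult_filter_quotient:
  "A \<otimes>\<^bsub>filter_quotient G \<phi> s\<^esub> B = A <#> B"
  by (simp add: filter_quotient_def set_mult_def)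

lemma group_filter_quotient: "group (filter_quotient G \<phi> s)"
  unfolding filter_quotient_def
  by (intro normal.factorgroup_is_group normal_restrict_supergroup subgroup_term
      normal_boundary boundary_subset_term)

lemma boundary_coset_subset:
  assumes "C \<in> carrier (filter_quotient G \<phi> s)"
  shows "C \<subseteq> \<phi> s"
proof
  fix y assume "y \<in> C"
  then obtain a x where "a \<in> boundary G \<phi> s" "x \<in> \<phi> s" "y = a \<otimes> x"
    using assms by (auto simp: carrier_filter_quotient r_coset_def)
  then show "y \<in> \<phi> s"
    using boundary_subset_term subgroup.m_closed[OF subgroup_term] by blast
qed

lemma boundary_coset_eq:
  assumes "C \<in> carrier (filter_quotient G \<phi> s)" "x \<in> C"
  shows "C = boundary G \<phi> s #> x"
proof -
  obtain y where "y \<in> \<phi> s" "C = boundary G \<phi> s #> y"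
    using assms(1) by (auto simp: carrier_filter_quotient)
  then show ?thesis
    using repr_independence[OF _ _ subgroup_boundary] assms(2) term_subset by blast
qed

lemma boundary_coset_nonempty:
  assumes "C \<in> carrier (filter_quotient G \<phi> s)"
  obtains x where "x \<in> C"
proof -
  obtain y where "y \<in> \<phi> s" "C = boundary G \<phi> s #> y"
    using assms by (auto simp: carrier_filter_quotient)
  then show ?thesis
    using rcos_self[OF _ subgroup_boundary] term_subset that by blast
qed

text \<open>This is \<open>[\<partial>\<phi>\<^sub>s, \<phi>\<^sub>t] \<le> \<partial>\<phi>\<^sub>s\<^sub>+\<^sub>t\<close> in terms of cosets. The elements that
  commute with \<open>\<phi>\<^sub>t\<close> modulo \<open>\<partial>\<phi>\<^sub>s\<^sub>+\<^sub>t\<close> form a subgroup, being the preimage of a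
  centralizer, so it is enough to test the generators \<open>\<phi>\<^sub>s\<^sub>+\<^sub>r\<close> of
  \<open>\<partial>\<phi>\<^sub>s\<close>, where \<open>[\<phi>\<^sub>s\<^sub>+\<^sub>r, \<phi>\<^sub>t] \<le> \<phi>\<^sub>s\<^sub>+\<^sub>t\<^sub>+\<^sub>r\<close>.\<close>

lemma boundary_commutes_mod:
  assumes "a \<in> boundary G \<phi> s" "y \<in> \<phi> t"
  defines "N \<equiv> boundary G \<phi> (s + t)"
  shows "(N #> a) \<otimes>\<^bsub>G Mod N\<^esub> (N #> y) = (N #> y) \<otimes>\<^bsub>G Mod N\<^esub> (N #> a)"
proof -
  have N: "N \<lhd> G" unfolding N_def by (rule normal_boundary)
  interpret N: normal N G by (rule N)
  interpret Q: group "G Mod N" by (rule N.factorgroup_is_group)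
  interpret p: group_hom G "G Mod N" "\<lambda>x. N #> x"
    by unfold_locales (rule N.r_coset_hom_Mod)
  define Z where "Z = {c \<in> carrier (G Mod N). \<forall>y\<in>(\<lambda>y. N #> y) ` \<phi> t. c \<otimes>\<^bsub>G Mod N\<^esub> y = y \<otimes>\<^bsub>G Mod N\<^esub> c}"
  have "subgroup Z (G Mod N)"
    unfolding Z_def
    by (intro Q.commuting_elements_subgroup image_subsetI p.hom_closed subsetD[OF term_subset])
  then have K: "subgroup {a \<in> carrier G. N #> a \<in> Z} G"
    by (rule p.subgroup_preimage)
  have "boundary G \<phi> s \<subseteq> {a \<in> carrier G. N #> a \<in> Z}"
  proof (rule boundary_least[OF K])
    fix r :: 'm assume r: "r \<noteq> 0"
    have "(N #> a) \<otimes>\<^bsub>G Mod N\<^esub> (N #> y) = (N #> y) \<otimes>\<^bsub>G Mod N\<^esub> (N #> a)"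
      if "a \<in> \<phi> (s + r)" "y \<in> \<phi> t" for a y
    proof (rule cosets_commute_if_commutator_mem[OF _ _ N])
      show "commutator G a y \<in> N"
        using commutator_mem[OF that] term_subset_boundary[OF r, of "s + t"]
        by (auto simp: N_def ac_simps)
    qed (use that term_subset in blast)+
    moreover have "a \<in> carrier G" "N #> a \<in> carrier (G Mod N)" if "a \<in> \<phi> (s + r)" for a
      using subsetD[OF term_subset that] by (blast, rule p.hom_closed)
    ultimately show "\<phi> (s + r) \<subseteq> {a \<in> carrier G. N #> a \<in> Z}"
      unfolding Z_def by blast
  qed
  then show ?thesis
    using assms(1,2) by (auto simp: Z_def)
qed

text \<open>For \<open>s \<noteq> 0\<close> the filter condition \<open>[\<phi>\<^sub>s, \<phi>\<^sub>s] \<le> \<phi>\<^sub>s\<^sub>+\<^sub>s\<close> already ends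
  in the boundary.\<close>

lemma comm_group_filter_quotient:
  assumes "s \<noteq> 0"
  shows "comm_group (filter_quotient G \<phi> s)"
proof -
  interpret Q: group "filter_quotient G \<phi> s" by (rule group_filter_quotient)
  show ?thesis
  proof (rule Q.group_comm_groupI)
    fix A B assume "A \<in> carrier (filter_quotient G \<phi> s)" "B \<in> carrier (filter_quotient G \<phi> s)"
    then obtain x y where xy: "x \<in> \<phi> s" "y \<in> \<phi> s"
      and AB: "A = boundary G \<phi> s #> x" "B = boundary G \<phi> s #> y"
      by (auto simp: carrier_filter_quotient)
    have "commutator G x y \<in> boundary G \<phi> s"
      using commutator_mem[OF xy] term_subset_boundary[OF assms] by blast
    then show "A \<otimes>\<^bsub>filter_quotient G \<phi> s\<^esub> B = B \<otimes>\<^bsub>filter_quotient G \<phi> s\<^esub> A"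
      using cosets_commute_if_commutator_mem[OF subsetD[OF term_subset xy(1)] subsetD[OF term_subset xy(2)] normal_boundary]
      by (simp add: AB mult_filter_quotient)
  qed
qed

text \<open>Other representatives are \<open>a \<otimes> x\<close> and \<open>b \<otimes> y\<close> with \<open>a\<close>, \<open>b\<close> in the
  boundaries. Modulo \<open>\<partial>\<phi>\<^sub>s\<^sub>+\<^sub>t\<close> these commute with \<open>\<phi>\<^sub>t\<close> and \<open>\<phi>\<^sub>s\<close> respectively, so
  the coset of the commutator is unchanged.\<close>

lemma homogeneous_lie_coset:
  assumes x: "x \<in> \<phi> s" and y: "y \<in> \<phi> t"
  shows "homogeneous_lie G \<phi> s t (boundary G \<phi> s #> x) (boundary G \<phi> t #> y)
       = boundary G \<phi> (s + t) #> commutator G x y"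
proof -
  define N where "N = boundary G \<phi> (s + t)"
  interpret N: normal N G unfolding N_def by (rule normal_boundary)
  interpret Q: group "G Mod N" by (rule N.factorgroup_is_group)
  interpret p: group_hom G "G Mod N" "\<lambda>x. N #> x"
    by unfold_locales (rule N.r_coset_hom_Mod)
  have *: "N #> commutator G (a \<otimes> x) (b \<otimes> y) = N #> commutator G x y"
    if a: "a \<in> boundary G \<phi> s" and b: "b \<in> boundary G \<phi> t" for a b
  proof -
    have carr: "a \<in> carrier G" "b \<in> carrier G" "x \<in> carrier G" "y \<in> carrier G"
      using a b x y boundary_subset term_subset by blast+
    have "b \<in> \<phi> t" using b boundary_subset_term by blast
    note comm = boundary_commutes_mod[OF a this, folded N_def]
      boundary_commutes_mod[OF a y, folded N_def]
      boundary_commutes_mod[OF b x, unfolded add.commute[of t s], folded N_def]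
    have "commutator (G Mod N) ((N #> a) \<otimes>\<^bsub>G Mod N\<^esub> (N #> x)) ((N #> b) \<otimes>\<^bsub>G Mod N\<^esub> (N #> y))
        = commutator (G Mod N) (N #> x) (N #> y)"
      using carr p.hom_closed comm by (intro Q.commutator_mult_commuting) blast+
    then show ?thesis
      using carr by (simp only: p.hom_commutator p.hom_mult m_closed)
  qed
  have ne: "boundary G \<phi> s \<noteq> {}" "boundary G \<phi> t \<noteq> {}"
    using subgroup.one_closed[OF subgroup_boundary] by blast+
  have "(\<lambda>(x, y). N #> commutator G x y) ` ((boundary G \<phi> s #> x) \<times> (boundary G \<phi> t #> y))
      = {N #> commutator G x y}" (is "?I = _")
  proof
    show "?I \<subseteq> {N #> commutator G x y}"
      by (auto simp: r_coset_def[of G "boundary G \<phi> s"] r_coset_def[of G "boundary G \<phi> t"] *)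
    moreover have "?I \<noteq> {}"
      using ne by (simp add: r_coset_def[of G "boundary G \<phi> s"] r_coset_def[of G "boundary G \<phi> t"])
    ultimately show "{N #> commutator G x y} \<subseteq> ?I"
      by (metis subset_singletonD order_refl)
  qed
  then show ?thesis
    by (simp add: homogeneous_lie_def N_def)
qed

lemma homogeneous_lie_closed:
  assumes "C \<in> carrier (filter_quotient G \<phi> s)" "D \<in> carrier (filter_quotient G \<phi> t)"
  shows "homogeneous_lie G \<phi> s t C D \<in> carrier (filter_quotient G \<phi> (s + t))"
  using assms commutator_mem by (auto simp: carrier_filter_quotient homogeneous_lie_coset)

lemma carrier_filter_lie_ring:
  "carrier (filter_lie_ring G \<phi>) =
    {f \<in> \<Pi>\<^sub>E s\<in>{s. s \<noteq> 0}. carrier (filter_quotient G \<phi> s).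
      finite {s \<in> {s. s \<noteq> 0}. f s \<noteq> \<one>\<^bsub>filter_quotient G \<phi> s\<^esub>}}"
  by (simp add: filter_lie_ring_def Let_def carrier_sum_group group_filter_quotient)

text \<open>A subgroup that contains the representatives and \<open>\<partial>\<phi>\<^sub>s\<close> also contains \<open>\<phi>\<^sub>s\<close>;
  inertia-freeness makes this an induction that reaches every term.\<close>

lemma representatives_generate:
  assumes inertia_free: "inertia_free G \<phi>"
    and transversal: "\<And>s. transversal G \<phi> s (\<tau> s)"
  shows "generate G (\<Union>s\<in>lift_indices G \<phi>. \<tau> s ` carrier (filter_quotient G \<phi> s)) = carrier G"
    (is "generate G ?X = _")
proof -
  have mem: "\<tau> s C \<in> C" if "C \<in> carrier (filter_quotient G \<phi> s)" for s C
    using transversal that by (auto simp: transversal_def)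
  have X: "?X \<subseteq> carrier G"
    using mem boundary_coset_subset term_subset by blast
  have gen: "subgroup (generate G ?X) G"
    by (rule generate_is_subgroup[OF X])
  have step: "\<phi> s \<subseteq> generate G ?X" if "boundary G \<phi> s \<subseteq> generate G ?X" for s
  proof (cases "s \<in> lift_indices G \<phi>")
    case True
    show ?thesis
    proof
      fix x assume x: "x \<in> \<phi> s"
      define C where "C = boundary G \<phi> s #> x"
      have C: "C \<in> carrier (filter_quotient G \<phi> s)"
        using x by (simp add: C_def carrier_filter_quotient)
      have "x \<in> C"
        using x rcos_self[OF _ subgroup_boundary] term_subset by (auto simp: C_def)
      then have "x \<in> boundary G \<phi> s #> \<tau> s C"
        using boundary_coset_eq[OF C mem[OF C]] by simp
      then obtain a where a: "a \<in> boundary G \<phi> s" "x = a \<otimes> \<tau> s C"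
        by (auto simp: r_coset_def)
      have "\<tau> s C \<in> generate G ?X"
        using True C by (blast intro: generate.incl)
      then show "x \<in> generate G ?X"
        using a that by (auto intro: generate.eng)
    qed
  next
    case False
    then show ?thesis
      using that by (simp add: lift_indices_def)
  qed
  have level: "K \<subseteq> generate G ?X" if "K \<in> inertia_free_level G \<phi> i" for i K
    using that
  proof (induction i arbitrary: K)
    case 0
    then show ?case by (simp add: generate.one)
  next
    case (Suc i)
    then obtain s B where "K = \<phi> s" and B: "B \<subseteq> inertia_free_level G \<phi> i"
      and bd: "boundary G \<phi> s = generate G (\<Union>B)"
      by auto
    have "\<Union>B \<subseteq> generate G ?X"
      using Suc.IH B by blast
    then have "boundary G \<phi> s \<subseteq> generate G ?X"
      unfolding bd using gen by (rule generate_subgroup_incl)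
    then show ?case
      unfolding \<open>K = \<phi> s\<close> by (rule step)
  qed
  have "\<phi> 0 \<in> (\<Union>i. inertia_free_level G \<phi> i)"
    using inertia_free by (simp add: inertia_free_def)
  then have "carrier G \<subseteq> generate G ?X"
    using level term_zero by auto
  then show ?thesis
    using generate_incl[OF X] by blast
qed

end

section \<open>Transport along an isomorphism\<close>

locale filter_iso = conic_filter G pre \<phi> + group_hom G H \<alpha>
  for G :: "('a, 'b) monoid_scheme" (structure) and pre and \<phi> :: "'m::comm_monoid_add \<Rightarrow> 'a set"
    and H :: "('c, 'd) monoid_scheme" (structure) and \<alpha> +
  assumes bij: "bij_betw \<alpha> (carrier G) (carrier H)"
begin

abbreviation "\<theta> \<equiv> induced_filter \<alpha> \<phi>"

lemma inj: "inj_on \<alpha> (carrier G)" and surj: "\<alpha> ` carrier G = carrier H"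
  using bij by (auto simp: bij_betw_def)

lemma boundary_induced: "boundary H \<theta> s = \<alpha> ` boundary G \<phi> s"
proof -
  have "(\<Union>t\<in>{t. t \<noteq> 0}. \<phi> (s + t)) \<subseteq> carrier G"
    using term_subset by blast
  then show ?thesis
    by (simp add: boundary_def induced_filter_def image_UN flip: generate_img)
qed

lemma mg_filter_induced: "mg_filter pre H \<theta>"
proof -
  have "\<alpha> ` \<phi> s \<lhd> H" for s
    by (rule normal.surj_hom_normal_subgroup[OF normal_term group_hom_axioms surj])
  moreover have "generate H (\<Union>s\<in>{s. s \<noteq> 0}. \<alpha> ` \<phi> s) = carrier H"
    using boundary_induced[of 0]
    by (simp only: boundary_zero surj) (simp add: boundary_def induced_filter_def)
  moreover have "(\<Inter>s. \<alpha> ` \<phi> s) = \<alpha> ` (\<Inter>s. \<phi> s)"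
    using inj term_subset by (intro image_INT[symmetric]) auto
  moreover have "commutator_subgroup H (\<alpha> ` \<phi> s) (\<alpha> ` \<phi> t) \<subseteq> \<alpha> ` \<phi> (s + t)" for s t
    using filter by (simp add: image_commutator_subgroup term_subset mg_filter_def image_mono)
  moreover have "pre s t \<longrightarrow> \<alpha> ` \<phi> t \<subseteq> \<alpha> ` \<phi> s" for s t
    using filter by (simp add: mg_filter_def image_mono)
  ultimately show ?thesis
    using filter by (simp add: mg_filter_def induced_filter_def)
qed

sublocale target: conic_filter H pre \<theta>
  using conic mg_filter_induced by unfold_locales

lemma image_boundary_coset:
  assumes "x \<in> \<phi> s"
  shows "\<alpha> ` (boundary G \<phi> s #>\<^bsub>G\<^esub> x) = boundary H \<theta> s #>\<^bsub>H\<^esub> \<alpha> x"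
  using assms term_subset boundary_subset by (auto simp: image_r_coset boundary_induced subset_iff)

lemma image_filter_quotient:
  "(`) \<alpha> ` carrier (filter_quotient G \<phi> s) = carrier (filter_quotient H \<theta> s)"
proof -
  have "(`) \<alpha> ` carrier (filter_quotient G \<phi> s) = (\<lambda>x. \<alpha> ` (boundary G \<phi> s #>\<^bsub>G\<^esub> x)) ` \<phi> s"
    by (simp only: carrier_filter_quotient image_image)
  also have "\<dots> = (\<lambda>x. boundary H \<theta> s #>\<^bsub>H\<^esub> \<alpha> x) ` \<phi> s"
    by (intro image_cong refl image_boundary_coset)
  also have "\<dots> = carrier (filter_quotient H \<theta> s)"
    by (simp only: target.carrier_filter_quotient induced_filter_def image_image)
  finally show ?thesis .
qed

lemma filter_quotient_iso:
  "(`) \<alpha> \<in> iso (filter_quotient G \<phi> s) (filter_quotient H \<theta> s)"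
proof (rule isoI)
  show "(`) \<alpha> \<in> hom (filter_quotient G \<phi> s) (filter_quotient H \<theta> s)"
  proof (rule homI)
    fix C assume "C \<in> carrier (filter_quotient G \<phi> s)"
    then show "\<alpha> ` C \<in> carrier (filter_quotient H \<theta> s)"
      using image_filter_quotient by blast
  next
    fix C D assume "C \<in> carrier (filter_quotient G \<phi> s)" "D \<in> carrier (filter_quotient G \<phi> s)"
    then have "C \<subseteq> carrier G" "D \<subseteq> carrier G"
      using boundary_coset_subset term_subset by (meson order_trans)+
    then show "\<alpha> ` (C \<otimes>\<^bsub>filter_quotient G \<phi> s\<^esub> D) = \<alpha> ` C \<otimes>\<^bsub>filter_quotient H \<theta> s\<^esub> \<alpha> ` D"
      by (simp add: mult_filter_quotient target.mult_filter_quotient image_set_mult)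
  qed
  have "carrier (filter_quotient G \<phi> s) \<subseteq> Pow (carrier G)"
    using boundary_coset_subset term_subset by (meson PowI order_trans subsetI)
  then have "inj_on ((`) \<alpha>) (carrier (filter_quotient G \<phi> s))"
    using inj_on_image_Pow[OF inj] by (rule inj_on_subset[rotated])
  then show "bij_betw ((`) \<alpha>) (carrier (filter_quotient G \<phi> s)) (carrier (filter_quotient H \<theta> s))"
    by (simp add: bij_betw_def image_filter_quotient)
qed

lemma image_eq_one_iff:
  assumes "C \<in> carrier (filter_quotient G \<phi> s)"
  shows "\<alpha> ` C = \<one>\<^bsub>filter_quotient H \<theta> s\<^esub> \<longleftrightarrow> C = \<one>\<^bsub>filter_quotient G \<phi> s\<^esub>"
proof -
  have "C \<subseteq> carrier G"
    using boundary_coset_subset[OF assms] term_subset by blast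
  then show ?thesis
    using inj_on_image_eq_iff[OF inj] boundary_subset
    by (simp add: one_filter_quotient target.one_filter_quotient boundary_induced)
qed

lemma image_one: "\<alpha> ` \<one>\<^bsub>filter_quotient G \<phi> s\<^esub> = \<one>\<^bsub>filter_quotient H \<theta> s\<^esub>"
  by (simp add: one_filter_quotient target.one_filter_quotient boundary_induced)

lemma homogeneous_lie_image:
  assumes "C \<in> carrier (filter_quotient G \<phi> s)" "D \<in> carrier (filter_quotient G \<phi> t)"
  shows "\<alpha> ` homogeneous_lie G \<phi> s t C D = homogeneous_lie H \<theta> s t (\<alpha> ` C) (\<alpha> ` D)"
proof -
  obtain x y where xy: "x \<in> \<phi> s" "y \<in> \<phi> t"
    and CD: "C = boundary G \<phi> s #>\<^bsub>G\<^esub> x" "D = boundary G \<phi> t #>\<^bsub>G\<^esub> y"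
    using assms by (auto simp: carrier_filter_quotient)
  have "\<alpha> x \<in> \<theta> s" "\<alpha> y \<in> \<theta> t" "x \<in> carrier G" "y \<in> carrier G"
    using xy term_subset by (auto simp: induced_filter_def)
  then show ?thesis
    using xy by (simp add: CD homogeneous_lie_coset image_boundary_coset commutator_mem
        target.homogeneous_lie_coset hom_commutator)
qed

text \<open>Since \<open>\<alpha>\<close> carries boundaries to boundaries, the coset of \<open>\<alpha> x\<close> is the same set
  for every \<open>x\<close> in \<open>C\<close>. It is this description of the induced map that all later arguments
  use.\<close>

lemma the_elem_image_coset:
  assumes "C \<in> carrier (filter_quotient G \<phi> s)"
  shows "the_elem ((\<lambda>x. boundary H \<theta> s #>\<^bsub>H\<^esub> \<alpha> x) ` C) = \<alpha> ` C"
proof -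
  have "boundary H \<theta> s #>\<^bsub>H\<^esub> \<alpha> x = \<alpha> ` C" if "x \<in> C" for x
    using boundary_coset_eq[OF assms that] boundary_coset_subset[OF assms] that
    by (metis image_boundary_coset subsetD)
  moreover obtain x where "x \<in> C"
    using boundary_coset_nonempty[OF assms] .
  ultimately have "(\<lambda>x. boundary H \<theta> s #>\<^bsub>H\<^esub> \<alpha> x) ` C = {\<alpha> ` C}"
    by auto
  then show ?thesis by simp
qed

lemma induced_lie_map_eq:
  assumes "f \<in> (\<Pi> s\<in>{s. s \<noteq> 0}. carrier (filter_quotient G \<phi> s))"
  shows "induced_lie_map \<phi> H \<alpha> f = (\<lambda>s\<in>{s. s \<noteq> 0}. \<alpha> ` f s)"
  using assms by (auto simp: induced_lie_map_def the_elem_image_coset Pi_def intro!: restrict_ext)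

lemma induced_lie_map_in_degree:
  assumes "C \<in> carrier (filter_quotient G \<phi> s)"
  shows "induced_lie_map \<phi> H \<alpha> (in_degree G \<phi> s C) = in_degree H \<theta> s (\<alpha> ` C)"
proof -
  have one: "\<one>\<^bsub>filter_quotient G \<phi> t\<^esub> \<in> carrier (filter_quotient G \<phi> t)" for t
    using group_filter_quotient by (simp add: group.subgroup_self subgroup.one_closed)
  then have "in_degree G \<phi> s C \<in> (\<Pi> t\<in>{t. t \<noteq> 0}. carrier (filter_quotient G \<phi> t))"
    using assms by (auto simp: in_degree_def)
  then show ?thesis
    unfolding in_degree_def[of H]
    by (subst induced_lie_map_eq) (assumption, rule restrict_ext, simp add: in_degree_def image_one)
qed

lemma induced_lie_map_iso:
  "induced_lie_map \<phi> H \<alpha> \<in> iso (filter_lie_ring G \<phi>) (filter_lie_ring H \<theta>)"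
proof (rule isoI)
  let ?\<beta> = "induced_lie_map \<phi> H \<alpha>"
  have eq: "?\<beta> f = (\<lambda>s\<in>{s. s \<noteq> 0}. \<alpha> ` f s)" if "f \<in> carrier (filter_lie_ring G \<phi>)" for f
    using that by (intro induced_lie_map_eq) (auto simp: carrier_filter_lie_ring)
  have comp: "f s \<in> carrier (filter_quotient G \<phi> s)"
    if "f \<in> carrier (filter_lie_ring G \<phi>)" "s \<noteq> 0" for f s
    using that by (auto simp: carrier_filter_lie_ring)
  have supp: "{s \<in> {s. s \<noteq> 0}. \<alpha> ` f s \<noteq> \<one>\<^bsub>filter_quotient H \<theta> s\<^esub>}
      = {s \<in> {s. s \<noteq> 0}. f s \<noteq> \<one>\<^bsub>filter_quotient G \<phi> s\<^esub>}"
    if "\<And>s. s \<noteq> 0 \<Longrightarrow> f s \<in> carrier (filter_quotient G \<phi> s)" for f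
    by (rule Collect_cong) (use that image_eq_one_iff in \<open>simp cong: conj_cong\<close>)
  have maps: "?\<beta> f \<in> carrier (filter_lie_ring H \<theta>)" if f: "f \<in> carrier (filter_lie_ring G \<phi>)" for f
  proof -
    have "\<alpha> ` f s \<in> carrier (filter_quotient H \<theta> s)" if "s \<noteq> 0" for s
      using comp[OF f that] image_filter_quotient by blast
    moreover have "{s \<in> {s. s \<noteq> 0}. ?\<beta> f s \<noteq> \<one>\<^bsub>filter_quotient H \<theta> s\<^esub>}
        = {s \<in> {s. s \<noteq> 0}. f s \<noteq> \<one>\<^bsub>filter_quotient G \<phi> s\<^esub>}"
      using supp[OF comp[OF f]] by (auto simp: eq[OF f])
    ultimately show ?thesis
      using f by (auto simp: target.carrier_filter_lie_ring carrier_filter_lie_ring eq[OF f])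
  qed
  show "?\<beta> \<in> hom (filter_lie_ring G \<phi>) (filter_lie_ring H \<theta>)"
  proof (rule homI)
    fix f g assume f: "f \<in> carrier (filter_lie_ring G \<phi>)" and g: "g \<in> carrier (filter_lie_ring G \<phi>)"
    have mult: "f \<otimes>\<^bsub>filter_lie_ring G \<phi>\<^esub> g = (\<lambda>s\<in>{s. s \<noteq> 0}. f s \<otimes>\<^bsub>filter_quotient G \<phi> s\<^esub> g s)"
      by (simp add: filter_lie_ring_def Let_def)
    have "?\<beta> (f \<otimes>\<^bsub>filter_lie_ring G \<phi>\<^esub> g)
        = (\<lambda>s\<in>{s. s \<noteq> 0}. \<alpha> ` (f s \<otimes>\<^bsub>filter_quotient G \<phi> s\<^esub> g s))"
      unfolding mult using comp[OF f] comp[OF g] group.is_monoid[OF group_filter_quotient]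
      by (subst induced_lie_map_eq) (auto intro: monoid.m_closed intro!: restrict_ext)
    also have "\<dots> = (\<lambda>s\<in>{s. s \<noteq> 0}. \<alpha> ` f s \<otimes>\<^bsub>filter_quotient H \<theta> s\<^esub> \<alpha> ` g s)"
      using Group.hom_mult[OF iso_imp_homomorphism[OF filter_quotient_iso] comp[OF f] comp[OF g]]
      by (intro restrict_ext) simp
    also have "\<dots> = ?\<beta> f \<otimes>\<^bsub>filter_lie_ring H \<theta>\<^esub> ?\<beta> g"
      by (auto intro!: restrict_ext simp: filter_lie_ring_def Let_def eq[OF f] eq[OF g])
    finally show "?\<beta> (f \<otimes>\<^bsub>filter_lie_ring G \<phi>\<^esub> g) = ?\<beta> f \<otimes>\<^bsub>filter_lie_ring H \<theta>\<^esub> ?\<beta> g" .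
  qed (rule maps)
  have inj_image: "C = D"
    if "\<alpha> ` C = \<alpha> ` D" "C \<in> carrier (filter_quotient G \<phi> s)" "D \<in> carrier (filter_quotient G \<phi> s)"
    for C D s
    using that filter_quotient_iso by (auto simp: iso_def bij_betw_def dest: inj_onD)
  have "inj_on ?\<beta> (carrier (filter_lie_ring G \<phi>))"
  proof (rule inj_onI)
    fix f g assume f: "f \<in> carrier (filter_lie_ring G \<phi>)" and g: "g \<in> carrier (filter_lie_ring G \<phi>)"
      and fg: "?\<beta> f = ?\<beta> g"
    show "f = g"
    proof (rule PiE_ext)
      show "f \<in> (\<Pi>\<^sub>E s\<in>{s. s \<noteq> 0}. carrier (filter_quotient G \<phi> s))"
        "g \<in> (\<Pi>\<^sub>E s\<in>{s. s \<noteq> 0}. carrier (filter_quotient G \<phi> s))"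
        using f g by (simp_all add: carrier_filter_lie_ring)
      fix s :: 'm assume "s \<in> {s. s \<noteq> 0}"
      then have s: "s \<noteq> 0" by simp
      show "f s = g s"
        using fun_cong[OF fg, of s] s inj_image[OF _ comp[OF f s] comp[OF g s]]
        by (simp add: eq[OF f] eq[OF g])
    qed
  qed
  moreover have "carrier (filter_lie_ring H \<theta>) \<subseteq> ?\<beta> ` carrier (filter_lie_ring G \<phi>)"
  proof
    fix g assume g: "g \<in> carrier (filter_lie_ring H \<theta>)"
    have "\<exists>C \<in> carrier (filter_quotient G \<phi> s). \<alpha> ` C = g s" if "s \<noteq> 0" for s
    proof -
      have "g s \<in> (`) \<alpha> ` carrier (filter_quotient G \<phi> s)"
        using g that by (auto simp: image_filter_quotient target.carrier_filter_lie_ring)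
      then show ?thesis by blast
    qed
    then obtain c where c: "\<And>s. s \<noteq> 0 \<Longrightarrow> c s \<in> carrier (filter_quotient G \<phi> s)"
      and cg: "\<And>s. s \<noteq> 0 \<Longrightarrow> \<alpha> ` c s = g s"
      by metis
    define f where "f = (\<lambda>s\<in>{s. s \<noteq> 0}. c s)"
    have "{s \<in> {s. s \<noteq> 0}. f s \<noteq> \<one>\<^bsub>filter_quotient G \<phi> s\<^esub>}
        = {s \<in> {s. s \<noteq> 0}. g s \<noteq> \<one>\<^bsub>filter_quotient H \<theta> s\<^esub>}"
      using supp[of c, OF c] by (simp add: f_def cg cong: conj_cong)
    then have f: "f \<in> carrier (filter_lie_ring G \<phi>)"
      using c g by (auto simp: carrier_filter_lie_ring target.carrier_filter_lie_ring f_def)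
    have "g \<in> extensional {s. s \<noteq> 0}"
      using g by (simp add: target.carrier_filter_lie_ring PiE_def)
    then have "?\<beta> f = g"
      by (intro extensionalityI[of _ "{s. s \<noteq> 0}"]) (simp_all add: eq[OF f], simp add: f_def cg)
    with f show "g \<in> ?\<beta> ` carrier (filter_lie_ring G \<phi>)" by blast
  qed
  ultimately show "bij_betw ?\<beta> (carrier (filter_lie_ring G \<phi>)) (carrier (filter_lie_ring H \<theta>))"
    using maps by (auto simp: bij_betw_def)
qed

text \<open>The image under \<open>\<alpha>\<close> is injective on each factor, so the two brackets are products over
  the same index set \<open>S u\<close>, and they can be compared factor by factor.\<close>

lemma induced_lie_map_lie:
  assumes f: "f \<in> carrier (filter_lie_ring G \<phi>)" and g: "g \<in> carrier (filter_lie_ring G \<phi>)"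
  shows "induced_lie_map \<phi> H \<alpha> (lie (filter_lie_ring G \<phi>) f g)
       = lie (filter_lie_ring H \<theta>) (induced_lie_map \<phi> H \<alpha> f) (induced_lie_map \<phi> H \<alpha> g)"
proof -
  define S where "S u = {(s, t). s \<noteq> 0 \<and> t \<noteq> 0 \<and> s + t = u \<and>
      f s \<noteq> \<one>\<^bsub>filter_quotient G \<phi> s\<^esub> \<and> g t \<noteq> \<one>\<^bsub>filter_quotient G \<phi> t\<^esub>}" for u
  have comp: "f s \<in> carrier (filter_quotient G \<phi> s)" "g s \<in> carrier (filter_quotient G \<phi> s)"
    if "s \<noteq> 0" for s
    using f g that by (auto simp: carrier_filter_lie_ring)
  have eq: "induced_lie_map \<phi> H \<alpha> f = (\<lambda>s\<in>{s. s \<noteq> 0}. \<alpha> ` f s)"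
    "induced_lie_map \<phi> H \<alpha> g = (\<lambda>s\<in>{s. s \<noteq> 0}. \<alpha> ` g s)"
    using comp by (auto intro: induced_lie_map_eq)
  have S: "S u = {(s, t). s \<noteq> 0 \<and> t \<noteq> 0 \<and> s + t = u \<and>
      induced_lie_map \<phi> H \<alpha> f s \<noteq> \<one>\<^bsub>filter_quotient H \<theta> s\<^esub> \<and>
      induced_lie_map \<phi> H \<alpha> g t \<noteq> \<one>\<^bsub>filter_quotient H \<theta> t\<^esub>}" for u
  proof -
    have "induced_lie_map \<phi> H \<alpha> f s = \<one>\<^bsub>filter_quotient H \<theta> s\<^esub> \<longleftrightarrow> f s = \<one>\<^bsub>filter_quotient G \<phi> s\<^esub>"
      "induced_lie_map \<phi> H \<alpha> g s = \<one>\<^bsub>filter_quotient H \<theta> s\<^esub> \<longleftrightarrow> g s = \<one>\<^bsub>filter_quotient G \<phi> s\<^esub>"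
      if "s \<noteq> 0" for s
      using that comp[OF that] by (simp_all add: eq image_eq_one_iff)
    then show ?thesis
      unfolding S_def by (simp cong: conj_cong)
  qed
  have summand: "(\<lambda>(s, t). homogeneous_lie G \<phi> s t (f s) (g t))
      \<in> S u \<rightarrow> carrier (filter_quotient G \<phi> u)" for u
    using comp homogeneous_lie_closed by (auto simp: S_def)
  have lie: "lie (filter_lie_ring G \<phi>) f g = (\<lambda>u\<in>{u. u \<noteq> 0}.
      finprod (filter_quotient G \<phi> u) (\<lambda>(s, t). homogeneous_lie G \<phi> s t (f s) (g t)) (S u))"
    by (simp add: filter_lie_ring_def Let_def S_def)
  have "\<alpha> ` finprod (filter_quotient G \<phi> u) (\<lambda>(s, t). homogeneous_lie G \<phi> s t (f s) (g t)) (S u)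
      = finprod (filter_quotient H \<theta> u) (\<lambda>(s, t). homogeneous_lie H \<theta> s t
          (induced_lie_map \<phi> H \<alpha> f s) (induced_lie_map \<phi> H \<alpha> g t)) (S u)"
    (is "\<alpha> ` finprod ?Q ?a (S u) = finprod ?R ?b (S u)") if u: "u \<noteq> 0" for u
  proof -
    interpret R: comm_group ?R by (rule target.comm_group_filter_quotient[OF u])
    have hom: "(`) \<alpha> \<in> hom ?Q ?R"
      using filter_quotient_iso by (simp add: iso_def)
    have term_eq: "\<alpha> ` ?a p = ?b p" if "p \<in> S u" for p
    proof -
      obtain s t where "p = (s, t)" "s \<noteq> 0" "t \<noteq> 0"
        using \<open>p \<in> S u\<close> by (auto simp: S_def)
      then show ?thesis
        by (simp add: eq homogeneous_lie_image comp)
    qed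
    have "?b p \<in> carrier ?R" if "p \<in> S u" for p
      using hom_in_carrier[OF hom funcset_mem[OF summand that]] unfolding term_eq[OF that] .
    then have "?b \<in> S u \<rightarrow> carrier ?R"
      by (rule Pi_I)
    then have "finprod ?R (\<lambda>p. \<alpha> ` ?a p) (S u) = finprod ?R ?b (S u)"
      using term_eq by (intro R.finprod_cong') auto
    then show ?thesis
      using hom_finprod_comm_group[OF comm_group_filter_quotient[OF u] R.comm_group_axioms hom summand]
      by simp
  qed
  note image_finprod = this
  have "lie (filter_lie_ring G \<phi>) f g \<in> (\<Pi> u\<in>{u. u \<noteq> 0}. carrier (filter_quotient G \<phi> u))"
    using comm_monoid.finprod_closed[OF comm_group.axioms(1)[OF comm_group_filter_quotient] summand]
    by (simp add: lie Pi_iff)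
  then have "induced_lie_map \<phi> H \<alpha> (lie (filter_lie_ring G \<phi>) f g) =
      (\<lambda>u\<in>{u. u \<noteq> 0}. finprod (filter_quotient H \<theta> u) (\<lambda>(s, t). homogeneous_lie H \<theta> s t
          (induced_lie_map \<phi> H \<alpha> f s) (induced_lie_map \<phi> H \<alpha> g t)) (S u))"
    by (simp only: induced_lie_map_eq) (rule restrict_ext, simp add: lie image_finprod)
  also have "\<dots> = lie (filter_lie_ring H \<theta>) (induced_lie_map \<phi> H \<alpha> f) (induced_lie_map \<phi> H \<alpha> g)"
    unfolding S by (simp add: filter_lie_ring_def Let_def)
  finally show ?thesis .
qed

lemma induced_lie_map_graded_iso: "graded_lie_iso G \<phi> H \<theta> (induced_lie_map \<phi> H \<alpha>)"
proof -
  have "induced_lie_map \<phi> H \<alpha> ` homogeneous_component G \<phi> s = homogeneous_component H \<theta> s" for s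
    by (auto simp: homogeneous_component_def image_image induced_lie_map_in_degree
        simp flip: image_filter_quotient)
  then show ?thesis
    by (simp add: graded_lie_iso_def induced_lie_map_iso induced_lie_map_lie)
qed

text \<open>In degree \<open>0\<close>, where \<open>graded_part\<close> is the unit by convention, the formula holds because
  \<open>C\<close> is the unit coset.\<close>

lemma graded_part_induced_lie_map:
  assumes "C \<in> carrier (filter_quotient G \<phi> s)"
  shows "graded_part G \<phi> H \<theta> (induced_lie_map \<phi> H \<alpha>) s C = \<alpha> ` C"
proof (cases "s = 0")
  case True
  then have "C = \<one>\<^bsub>filter_quotient G \<phi> 0\<^esub>"
    using assms by (simp add: filter_quotient_zero)
  then show ?thesis
    using True by (simp add: graded_part_def image_one)
next
  case False
  then show ?thesis
    using assms by (simp add: graded_part_def induced_lie_map_in_degree) (simp add: in_degree_def)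
qed

lemma lift_of_induced_lie_map:
  assumes "inertia_free G \<phi>"
  shows "lift_of pre G \<phi> H \<theta> (induced_lie_map \<phi> H \<alpha>) \<alpha>"
proof -
  define \<tau> :: "'m \<Rightarrow> 'a set \<Rightarrow> 'a" where "\<tau> s C = (SOME x. x \<in> C)" for s C
  have \<tau>_mem: "\<tau> s C \<in> C" if "C \<in> carrier (filter_quotient G \<phi> s)" for s C
    using boundary_coset_nonempty[OF that] by (metis \<tau>_def someI)
  define \<sigma> where "\<sigma> s D = \<alpha> (\<tau> s (inv_into (carrier (filter_quotient G \<phi> s)) ((`) \<alpha>) D))" for s D
  have \<sigma>_image: "\<sigma> s (\<alpha> ` C) = \<alpha> (\<tau> s C)" if "C \<in> carrier (filter_quotient G \<phi> s)" for s C
    using filter_quotient_iso that by (simp add: \<sigma>_def iso_def bij_betw_def)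
  have \<tau>: "transversal G \<phi> s (\<tau> s)" for s
    by (simp add: transversal_def \<tau>_mem)
  have \<sigma>: "transversal H \<theta> s (\<sigma> s)" for s
    by (auto simp: transversal_def \<sigma>_image \<tau>_mem simp flip: image_filter_quotient)
  have generates: "generate (filter_quotient G \<phi> s) (carrier (filter_quotient G \<phi> s))
      = carrier (filter_quotient G \<phi> s)" for s
    using group.generateI[OF group_filter_quotient group.subgroup_self[OF group_filter_quotient]]
    by blast
  have "\<alpha> x = partial_lift G \<phi> H \<theta> (induced_lie_map \<phi> H \<alpha>) \<sigma> s x"
    if C: "C \<in> carrier (filter_quotient G \<phi> s)" and x: "x = \<tau> s C"
    for s x C
  proof -
    have "boundary G \<phi> s #>\<^bsub>G\<^esub> x = C"
      using boundary_coset_eq[OF C \<tau>_mem[OF C]] x by simp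
    then show ?thesis
      by (simp add: partial_lift_def graded_part_induced_lie_map[OF C] \<sigma>_image[OF C] x)
  qed
  then show ?thesis
    unfolding lift_of_def
    using filter mg_filter_induced induced_lie_map_graded_iso homh \<tau> \<sigma> generates
      representatives_generate[OF assms \<tau>]
    by (intro conjI exI[of _ \<tau>] exI[of _ \<sigma>] exI[of _ "\<lambda>s. carrier (filter_quotient G \<phi> s)"]) auto
qed

end

theorem theorem4:
  fixes G :: "('a, 'b) monoid_scheme" and H :: "('c, 'd) monoid_scheme"
    and pre :: "'m::comm_monoid_add \<Rightarrow> 'm \<Rightarrow> bool"
    and \<alpha> :: "'a \<Rightarrow> 'c" and \<phi> :: "'m \<Rightarrow> 'a set"
  assumes "finitely_generated_group G" and "nilpotent_group G"
    and "finitely_generated_group H" and "nilpotent_group H"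
    and "conically_preordered pre" and "finitely_generated_monoid TYPE('m)"
    and "\<alpha> \<in> iso G H"
    and "mg_filter pre G \<phi>"
    and "finite_filter \<phi>" and "inertia_free G \<phi>" and "faithful_filter G \<phi>"
  shows "lift_of pre G \<phi> H (induced_filter \<alpha> \<phi>) (induced_lie_map \<phi> H \<alpha>) \<alpha>"
proof -
  have "filter_iso G pre \<phi> H \<alpha>"
    using assms
    by (auto simp: filter_iso_def filter_iso_axioms_def conic_filter_def conic_filter_axioms_def
        group_hom_def group_hom_axioms_def finitely_generated_group_def iso_def)
  then show ?thesis
    using assms by (intro filter_iso.lift_of_induced_lie_map)
qed

end
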